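(* Let $(\mathcal{P},\mathcal{H})$ be an intersection-closed hypothesis space and let $\varepsilon$ be an E-capacity kernel for $\mathcal{H}$. Then $\varepsilon$ is valid, i.e. $\mathbb{E}^P[\varepsilon(H\mid X)]\le1$ for every nonempty $H\in\mathcal{H}$ and every $P\in H$, if and only if it controls the familywise evidence, i.e. $$\sup_{P\in\mathcal{P}}\mathbb{E}^P\left[\sup_{H\in\mathcal{H}:H\ni P}\varepsilon(H\mid X)\right]\le1.$$
   Context: $(\mathcal{X},\Sigma)$ is a measurable space and $\mathcal{P}$ a collection of probability measures on it; $\mathbb{E}^P$ is expectation when $X\in\mathcal{X}$ has law $P$. A hypothesis class $\mathcal{H}$ is a collection of subsets of $\mathcal{P}$ closed under arbitrary unions (including the empty union, so $\emptyset\in\mathcal{H}$); $(\mathcal{P},\mathcal{H})$ is then a hypothesis space. It is intersection-closed if $\mathcal{H}$ is also closed under arbitrary intersections and $\mathcal{P}\in\mathcal{H}$. An E-capacity is a map $\varepsilon:\mathcal{H}\to[0,\infty]$ with $\varepsilon(\emptyset)=\infty$ and $\varepsilon(H')\le\varepsilon(H)$ whenever $H\subseteq H'$, $H,H'\in\mathcal{H}$. An E-capacity kernel is a map $\varepsilon:\mathcal{H}\times\mathcal{X}\to[0,\infty]$, written $\varepsilon(H\mid x)$, with $x\mapsto\varepsilon(H\mid x)$ $\Sigma$-measurable for every $H\in\mathcal{H}$ and $H\mapsto\varepsilon(H\mid x)$ an E-capacity for every $x\in\mathcal{X}$. *)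

theory Defs
  imports "HOL-Probability.Probability"
begin

text \<open>
  The measurable space \<open>(X, \<Sigma>)\<close> is represented by \<open>M :: 'a measure\<close>, of which only
  \<open>space M\<close> and \<open>sets M\<close> are used.
\<close>

definition prob_measures_on :: "'a measure \<Rightarrow> 'a measure set \<Rightarrow> bool" where
  "prob_measures_on M \<P> \<longleftrightarrow> (\<forall>P\<in>\<P>. prob_space P \<and> sets P = sets M)"

definition hypothesis_class :: "'p set \<Rightarrow> 'p set set \<Rightarrow> bool" where
  "hypothesis_class \<P> \<H> \<longleftrightarrow> \<H> \<subseteq> Pow \<P> \<and> (\<forall>\<S>\<subseteq>\<H>. \<Union>\<S> \<in> \<H>)"

definition hypothesis_space :: "'a measure \<Rightarrow> 'a measure set \<Rightarrow> 'a measure set set \<Rightarrow> bool" where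
  "hypothesis_space M \<P> \<H> \<longleftrightarrow> prob_measures_on M \<P> \<and> hypothesis_class \<P> \<H>"

text \<open>
  The empty intersection is read relative to \<open>\<P>\<close>. It has to be treated separately
  because \<open>\<Inter>{} = UNIV\<close>.
\<close>

definition intersection_closed :: "'p set \<Rightarrow> 'p set set \<Rightarrow> bool" where
  "intersection_closed \<P> \<H> \<longleftrightarrow>
     \<P> \<in> \<H> \<and> (\<forall>\<S>\<subseteq>\<H>. \<S> \<noteq> {} \<longrightarrow> \<Inter>\<S> \<in> \<H>)"

definition E_capacity :: "'p set set \<Rightarrow> ('p set \<Rightarrow> ennreal) \<Rightarrow> bool" where
  "E_capacity \<H> \<epsilon> \<longleftrightarrow>
     \<epsilon> {} = \<infinity> \<and> (\<forall>H\<in>\<H>. \<forall>H'\<in>\<H>. H \<subseteq> H' \<longrightarrow> \<epsilon> H' \<le> \<epsilon> H)"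

text \<open>The kernel value written \<open>\<epsilon>(H | x)\<close> is \<open>\<epsilon> H x\<close>; values outside \<open>\<H> \<times> space M\<close> are unconstrained.\<close>

definition E_capacity_kernel ::
    "'a measure \<Rightarrow> 'p set set \<Rightarrow> ('p set \<Rightarrow> 'a \<Rightarrow> ennreal) \<Rightarrow> bool" where
  "E_capacity_kernel M \<H> \<epsilon> \<longleftrightarrow>
     (\<forall>H\<in>\<H>. \<epsilon> H \<in> borel_measurable M) \<and>
     (\<forall>x\<in>space M. E_capacity \<H> (\<lambda>H. \<epsilon> H x))"

definition valid_kernel ::
    "'a measure set set \<Rightarrow> ('a measure set \<Rightarrow> 'a \<Rightarrow> ennreal) \<Rightarrow> bool" where
  "valid_kernel \<H> \<epsilon> \<longleftrightarrow>
     (\<forall>H\<in>\<H>. H \<noteq> {} \<longrightarrow> (\<forall>P\<in>H. (\<integral>\<^sup>+x. \<epsilon> H x \<partial>P) \<le> 1))"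

text \<open>
  When \<open>\<H>\<close> is intersection-closed, the inner supremum is attained at the smallest
  hypothesis containing \<open>P\<close>, so the integrand is measurable and the nonnegative integral is the
  expectation in the usual sense.
\<close>

definition controls_familywise_evidence ::
    "'a measure set \<Rightarrow> 'a measure set set \<Rightarrow> ('a measure set \<Rightarrow> 'a \<Rightarrow> ennreal) \<Rightarrow> bool" where
  "controls_familywise_evidence \<P> \<H> \<epsilon> \<longleftrightarrow>
     (SUP P\<in>\<P>. \<integral>\<^sup>+x. (SUP H\<in>{H\<in>\<H>. P \<in> H}. \<epsilon> H x) \<partial>P) \<le> 1"

end

theory Submission
  imports Defs
begin

text \<open>Intersection-closedness gives each \<open>P\<close> in \<open>\<P>\<close> a smallest
  hypothesis containing it, the intersection of all hypotheses that contain \<open>P\<close>.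
  Evidence decreases as hypotheses grow, so at every sample point the supremum over the hypotheses
  containing \<open>P\<close> is attained there, at one hypothesis that does not depend on the point
  (\<open>SUP_kernel_eq_smallest\<close>). The familywise expectation under \<open>P\<close> is thus
  an ordinary expectation of the kernel at a single true hypothesis, which validity bounds by 1.
  Conversely, the kernel at any hypothesis containing \<open>P\<close> lies below the
  supremum.\<close>

lemma smallest_hypothesis_mem:
  assumes "intersection_closed \<P> \<H>" "P \<in> \<P>"
  shows "\<Inter>{H\<in>\<H>. P \<in> H} \<in> {H\<in>\<H>. P \<in> H}"
proof -
  \<comment> \<open>The whole of \<open>\<P>\<close> witnesses that the family is nonempty, so its
    intersection is a genuine hypothesis and not \<open>UNIV\<close>.\<close>
  have "\<P> \<in> {H\<in>\<H>. P \<in> H}"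
    using assms unfolding intersection_closed_def by simp
  then have "{H\<in>\<H>. P \<in> H} \<noteq> {}"
    by (metis empty_iff)
  moreover have "{H\<in>\<H>. P \<in> H} \<subseteq> \<H>"
    by (rule Collect_restrict)
  ultimately have "\<Inter>{H\<in>\<H>. P \<in> H} \<in> \<H>"
    using assms(1) unfolding intersection_closed_def by simp
  then show ?thesis
    by simp
qed

text \<open>The intersection lies below every competitor, so antitonicity makes its value an upper
  bound; being a competitor itself, it attains the bound.\<close>

lemma SUP_kernel_eq_smallest:
  assumes "intersection_closed \<P> \<H>" "P \<in> \<P>" "E_capacity \<H> e"
  shows "(SUP H\<in>{H\<in>\<H>. P \<in> H}. e H) = e (\<Inter>{H\<in>\<H>. P \<in> H})"
proof (rule antisym)
  have mem: "\<Inter>{H\<in>\<H>. P \<in> H} \<in> {H\<in>\<H>. P \<in> H}"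
    using assms(1,2) by (rule smallest_hypothesis_mem)
  show "(SUP H\<in>{H\<in>\<H>. P \<in> H}. e H) \<le> e (\<Inter>{H\<in>\<H>. P \<in> H})"
  proof (rule SUP_least)
    fix H assume "H \<in> {H\<in>\<H>. P \<in> H}"
    moreover from this have "\<Inter>{H\<in>\<H>. P \<in> H} \<subseteq> H"
      by (rule Inter_lower)
    ultimately show "e H \<le> e (\<Inter>{H\<in>\<H>. P \<in> H})"
      using assms(3) mem unfolding E_capacity_def by simp
  qed
  show "e (\<Inter>{H\<in>\<H>. P \<in> H}) \<le> (SUP H\<in>{H\<in>\<H>. P \<in> H}. e H)"
    using mem by (rule SUP_upper)
qed

theorem theorem6:
  fixes M :: "'a measure"
    and \<P> :: "'a measure set"
    and \<H> :: "'a measure set set"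
    and \<epsilon> :: "'a measure set \<Rightarrow> 'a \<Rightarrow> ennreal"
  assumes "hypothesis_space M \<P> \<H>"
    and "intersection_closed \<P> \<H>"
    and "E_capacity_kernel M \<H> \<epsilon>"
  shows "valid_kernel \<H> \<epsilon> \<longleftrightarrow> controls_familywise_evidence \<P> \<H> \<epsilon>"
proof
  assume valid: "valid_kernel \<H> \<epsilon>"
  show "controls_familywise_evidence \<P> \<H> \<epsilon>"
    unfolding controls_familywise_evidence_def
  proof (rule SUP_least)
    fix P assume P: "P \<in> \<P>"
    let ?H = "\<Inter>{H\<in>\<H>. P \<in> H}"
    \<comment> \<open>The capacity property holds only at points of \<open>space M\<close>, while
      the integral ranges over \<open>space P\<close>.\<close>
    have "space P = space M"
      using assms(1) P unfolding hypothesis_space_def prob_measures_on_def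
      by (metis sets_eq_imp_space_eq)
    then have "(\<integral>\<^sup>+x. (SUP H\<in>{H\<in>\<H>. P \<in> H}. \<epsilon> H x) \<partial>P) = (\<integral>\<^sup>+x. \<epsilon> ?H x \<partial>P)"
      using assms(3) unfolding E_capacity_kernel_def
      by (intro nn_integral_cong SUP_kernel_eq_smallest[OF assms(2) P]) simp
    also have "\<dots> \<le> 1"
    proof -
      have "?H \<in> \<H>" "P \<in> ?H"
        using smallest_hypothesis_mem[OF assms(2) P] by simp_all
      then show ?thesis
        using valid unfolding valid_kernel_def by (metis empty_iff)
    qed
    finally show "(\<integral>\<^sup>+x. (SUP H\<in>{H\<in>\<H>. P \<in> H}. \<epsilon> H x) \<partial>P) \<le> 1" .
  qed
next
  assume control: "controls_familywise_evidence \<P> \<H> \<epsilon>"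
  show "valid_kernel \<H> \<epsilon>"
    unfolding valid_kernel_def
  proof (intro ballI impI)
    fix H P assume H: "H \<in> \<H>" and P: "P \<in> H"
    have "P \<in> \<P>"
      using assms(1) H P unfolding hypothesis_space_def hypothesis_class_def by blast
    \<comment> \<open>Since \<open>P\<close> belongs to \<open>H\<close>, the hypothesis
      \<open>H\<close> is itself one of the competitors in the supremum.\<close>
    have "(\<integral>\<^sup>+x. \<epsilon> H x \<partial>P) \<le> (\<integral>\<^sup>+x. (SUP H\<in>{H\<in>\<H>. P \<in> H}. \<epsilon> H x) \<partial>P)"
      using H P by (intro nn_integral_mono SUP_upper) simp
    also have "\<dots> \<le> 1"
      using control \<open>P \<in> \<P>\<close> unfolding controls_familywise_evidence_def
      by (simp add: SUP_le_iff)
    finally show "(\<integral>\<^sup>+x. \<epsilon> H x \<partial>P) \<le> 1" .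
  qed
qed

end
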